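(* Let $\mathbf c=(1,1,\dots,1)\in\mathbb Z^n$ and let $M$ be a proper $\mathbf c$-multicomplex in the variables $x_1,\dots,x_n$. Let $\Delta=\{\{i_1,\dots,i_k\}\subset[n]:x_{i_1}\cdots x_{i_k}\in M\}$. Then $\mathrm{Bier}_{\mathbf c}(M)$ is combinatorially isomorphic to $\mathrm{Bier}(\Delta)$.
   Context: Write $x^{\mathbf a}=x_1^{a_1}\cdots x_n^{a_n}$. For $\mathbf c\in\mathbb Z_{\ge0}^n$, a $\mathbf c$-monomial is $x^{\mathbf a}$ with $a_i\le c_i$ for all $i$; a $\mathbf c$-multicomplex is a nonempty set of $\mathbf c$-monomials closed under taking divisors, proper if it is not the set of all $\mathbf c$-monomials. Let $\widetilde X=\{x_i^{(j)}:1\le i\le n,\ 0\le j\le c_i\}$ (new symbols). For a $\mathbf c$-monomial $x^{\mathbf a}$ put $F_{\mathbf c}(x^{\mathbf a})=\widetilde X\setminus\{x_1^{(a_1)},\dots,x_n^{(a_n)}\}$; $\mathcal B_{\mathbf c}(M)$ is the simplicial complex of all subsets of the sets $F_{\mathbf c}(x^{\mathbf a})$, $x^{\mathbf a}\in M$. For a pure $(d-1)$-dimensional complex $B$, $\partial B$ is the complex generated by the $(d-1)$-element faces lying in exactly one facet; $\mathrm{Bier}_{\mathbf c}(M)=\partial\mathcal B_{\mathbf c}(M)$. For a simplicial complex $\Delta$ on $[n]$ with $\Delta\neq 2^{[n]}$, its Alexander dual is $\Delta^\vee=\{F\subset[n]:[n]\setminus F\notin\Delta\}$, and its (classical) Bier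 sphere is the simplicial complex on $\{x_1,\dots,x_n,y_1,\dots,y_n\}$ given by $\mathrm{Bier}(\Delta)=\{X_F\cup Y_G:F\in\Delta,\ G\in\Delta^\vee,\ F\cap G=\emptyset\}$ with $X_F=\{x_i:i\in F\}$, $Y_G=\{y_i:i\in G\}$. Two simplicial complexes are combinatorially isomorphic if there is a bijection between their vertex sets carrying faces exactly onto faces. *)

theory Defs
  imports Main
begin

text \<open>
  A monomial in \<open>x\<^sub>1, \<dots>, x\<^sub>n\<close> is represented by its exponent vector, a function \<open>nat \<Rightarrow> nat\<close> that
  vanishes outside \<open>{1..n}\<close>. Divisibility of monomials is then the pointwise order.
\<close>

definition c_monomials :: "nat \<Rightarrow> (nat \<Rightarrow> nat) \<Rightarrow> (nat \<Rightarrow> nat) set" where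
  "c_monomials n c = {a. (\<forall>i\<in>{1..n}. a i \<le> c i) \<and> (\<forall>i. i \<notin> {1..n} \<longrightarrow> a i = 0)}"

definition c_multicomplex :: "nat \<Rightarrow> (nat \<Rightarrow> nat) \<Rightarrow> (nat \<Rightarrow> nat) set \<Rightarrow> bool" where
  "c_multicomplex n c M \<longleftrightarrow>
     M \<noteq> {} \<and> M \<subseteq> c_monomials n c \<and> (\<forall>a\<in>M. \<forall>b. (\<forall>i. b i \<le> a i) \<longrightarrow> b \<in> M)"

definition proper_c_multicomplex :: "nat \<Rightarrow> (nat \<Rightarrow> nat) \<Rightarrow> (nat \<Rightarrow> nat) set \<Rightarrow> bool" where
  "proper_c_multicomplex n c M \<longleftrightarrow> c_multicomplex n c M \<and> M \<noteq> c_monomials n c"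

text \<open>A simplicial complex is represented by its set of faces.\<close>

definition facets :: "'v set set \<Rightarrow> 'v set set" where
  "facets B = {F \<in> B. \<forall>G\<in>B. F \<subseteq> G \<longrightarrow> G = F}"

definition pure_complex :: "nat \<Rightarrow> 'v set set \<Rightarrow> bool" where
  "pure_complex d B \<longleftrightarrow> (\<forall>F\<in>facets B. finite F \<and> card F = d)"

text \<open>
  For a finite pure complex \<open>B\<close>, the number \<open>Max (card ` B)\<close> is the common cardinality \<open>d\<close> of its
  facets. The boundary is only meaningful for such complexes; purity of \<open>\<B>\<^sub>c(M)\<close> is proved below.
\<close>

definition boundary :: "'v set set \<Rightarrow> 'v set set" where
  "boundary B = {S. \<exists>G\<in>B. S \<subseteq> G \<and> card G + 1 = Max (card ` B) \<and> (\<exists>!F. F \<in> facets B \<and> G \<subseteq> F)}"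

text \<open>The symbol \<open>x\<^sub>i\<^sup>(\<^sup>j\<^sup>)\<close> is the pair \<open>(i, j)\<close>.\<close>

definition Xtilde :: "nat \<Rightarrow> (nat \<Rightarrow> nat) \<Rightarrow> (nat \<times> nat) set" where
  "Xtilde n c = {(i, j). i \<in> {1..n} \<and> j \<le> c i}"

definition F_c :: "nat \<Rightarrow> (nat \<Rightarrow> nat) \<Rightarrow> (nat \<Rightarrow> nat) \<Rightarrow> (nat \<times> nat) set" where
  "F_c n c a = Xtilde n c - (\<lambda>i. (i, a i)) ` {1..n}"

definition B_c :: "nat \<Rightarrow> (nat \<Rightarrow> nat) \<Rightarrow> (nat \<Rightarrow> nat) set \<Rightarrow> (nat \<times> nat) set set" where
  "B_c n c M = {S. \<exists>a\<in>M. S \<subseteq> F_c n c a}"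

definition Bier_c :: "nat \<Rightarrow> (nat \<Rightarrow> nat) \<Rightarrow> (nat \<Rightarrow> nat) set \<Rightarrow> (nat \<times> nat) set set" where
  "Bier_c n c M = boundary (B_c n c M)"

definition alexander_dual :: "nat \<Rightarrow> nat set set \<Rightarrow> nat set set" where
  "alexander_dual n \<Delta> = {F. F \<subseteq> {1..n} \<and> {1..n} - F \<notin> \<Delta>}"

text \<open>The vertices \<open>x\<^sub>i\<close> and \<open>y\<^sub>i\<close> of the classical Bier sphere are \<open>Inl i\<close> and \<open>Inr i\<close>.\<close>

definition Bier_vertices :: "nat \<Rightarrow> (nat + nat) set" where
  "Bier_vertices n = Inl ` {1..n} \<union> Inr ` {1..n}"

definition Bier :: "nat \<Rightarrow> nat set set \<Rightarrow> (nat + nat) set set" where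
  "Bier n \<Delta> = {Inl ` F \<union> Inr ` G | F G. F \<in> \<Delta> \<and> G \<in> alexander_dual n \<Delta> \<and> F \<inter> G = {}}"

text \<open>The exponent vector of the squarefree monomial \<open>\<Prod>i\<in>F. x\<^sub>i\<close>.\<close>

definition squarefree_monomial :: "nat set \<Rightarrow> nat \<Rightarrow> nat" where
  "squarefree_monomial F = (\<lambda>i. if i \<in> F then 1 else 0)"

definition complex_of_multicomplex :: "nat \<Rightarrow> (nat \<Rightarrow> nat) set \<Rightarrow> nat set set" where
  "complex_of_multicomplex n M = {F. F \<subseteq> {1..n} \<and> squarefree_monomial F \<in> M}"

text \<open>
  \<open>\<Delta>\<close> is a complex on the vertex set \<open>V\<close> and \<open>\<Gamma>\<close> one on \<open>W\<close>. As usual for Alexander duality, a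
  complex on \<open>V\<close> need not contain every \<open>{v}\<close> with \<open>v \<in> V\<close>, so the vertex set is not determined by
  the faces and is given explicitly.
\<close>

definition combinatorially_isomorphic ::
    "'v set \<Rightarrow> 'v set set \<Rightarrow> 'w set \<Rightarrow> 'w set set \<Rightarrow> bool" where
  "combinatorially_isomorphic V \<Delta> W \<Gamma> \<longleftrightarrow>
     \<Delta> \<subseteq> Pow V \<and> \<Gamma> \<subseteq> Pow W \<and> (\<exists>f. bij_betw f V W \<and> (\<lambda>S. f ` S) ` \<Delta> = \<Gamma>)"

text \<open>Such an isomorphism restricts to one between the sets of vertices that are faces.\<close>

lemma combinatorially_isomorphic_Union:
  assumes "combinatorially_isomorphic V \<Delta> W \<Gamma>"
  shows "combinatorially_isomorphic (\<Union>\<Delta>) \<Delta> (\<Union>\<Gamma>) \<Gamma>"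
proof -
  obtain f where f: "bij_betw f V W" "(\<lambda>S. f ` S) ` \<Delta> = \<Gamma>" and V: "\<Delta> \<subseteq> Pow V"
    using assms by (auto simp: combinatorially_isomorphic_def)
  have "inj_on f (\<Union>\<Delta>)"
    using f(1) V by (meson Sup_le_iff PowD bij_betw_def inj_on_subset subsetD)
  moreover have "f ` \<Union>\<Delta> = \<Union>\<Gamma>"
    using f(2) by blast
  ultimately have "bij_betw f (\<Union>\<Delta>) (\<Union>\<Gamma>)"
    by (simp add: bij_betw_def)
  then show ?thesis
    using f(2) by (auto simp: combinatorially_isomorphic_def)
qed

lemma finite_Xtilde: "finite (Xtilde n c)"
proof -
  have "Xtilde n c = (SIGMA i:{1..n}. {..c i})"
    by (auto simp: Xtilde_def)
  then show ?thesis by simp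
qed

lemma card_F_c:
  assumes "a \<in> c_monomials n c"
  shows "card (F_c n c a) = (\<Sum>i=1..n. c i)"
proof -
  have X: "Xtilde n c = (SIGMA i:{1..n}. {..c i})"
    by (auto simp: Xtilde_def)
  have sub: "(\<lambda>i. (i, a i)) ` {1..n} \<subseteq> Xtilde n c"
    using assms by (auto simp: Xtilde_def c_monomials_def)
  have "card ((\<lambda>i. (i, a i)) ` {1..n}) = n"
    by (subst card_image) (auto simp: inj_on_def)
  moreover have "card (Xtilde n c) = (\<Sum>i=1..n. c i) + n"
    by (simp add: X sum.distrib[symmetric] sum_Suc)
  ultimately show ?thesis
    using sub by (simp add: F_c_def card_Diff_subset)
qed

lemma pure_B_c:
  assumes "c_multicomplex n c M"
  shows "pure_complex (\<Sum>i=1..n. c i) (B_c n c M)"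
    and "Max (card ` B_c n c M) = (\<Sum>i=1..n. c i)"
proof -
  let ?d = "\<Sum>i=1..n. c i"
  have fin: "finite (F_c n c a)" for a
    using finite_Xtilde by (auto simp: F_c_def)
  have M: "card (F_c n c a) = ?d" if "a \<in> M" for a
    using assms that card_F_c by (auto simp: c_multicomplex_def)
  have "F \<in> F_c n c ` M" if "F \<in> facets (B_c n c M)" for F
    using that by (fastforce simp: facets_def B_c_def)
  then show "pure_complex ?d (B_c n c M)"
    using fin M by (fastforce simp: pure_complex_def)
  have "B_c n c M \<subseteq> Pow (Xtilde n c)"
    by (auto simp: B_c_def F_c_def)
  then have finB: "finite (B_c n c M)"
    using finite_Xtilde finite_subset by blast
  obtain a where a: "a \<in> M"
    using assms by (auto simp: c_multicomplex_def)
  show "Max (card ` B_c n c M) = ?d"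
  proof (rule Max_eqI)
    show "finite (card ` B_c n c M)" using finB by simp
    show "?d \<in> card ` B_c n c M"
      using a M[OF a] by (force simp: B_c_def)
    show "y \<le> ?d" if "y \<in> card ` B_c n c M" for y
      using that M fin by (auto simp: B_c_def) (metis card_mono)
  qed
qed

end

theory Submission
  imports Defs
begin

text \<open>
  For \<open>c = (1, \<dots>, 1)\<close> the squarefree monomial of \<open>A\<close> gives the facet consisting of the
  \<open>x\<^sub>i\<^sup>(\<^sup>0\<^sup>)\<close> with \<open>i \<in> A\<close> and the \<open>x\<^sub>i\<^sup>(\<^sup>1\<^sup>)\<close> with \<open>i \<notin> A\<close>. Dropping its element with index \<open>i\<close>
  leaves a ridge whose only other possible facet belongs to the symmetric difference of \<open>A\<close> and
  \<open>{i}\<close>. As \<open>\<Delta>\<close> is closed under subsets, the boundary is generated by the ridges with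
  \<open>A \<in> \<Delta>\<close> and \<open>A \<union> {i} \<notin> \<Delta>\<close>. A set \<open>X\<^sub>F \<union> Y\<^sub>G\<close> lies in such a ridge iff \<open>F \<subseteq> A\<close> and
  \<open>A \<union> {i} \<subseteq> [n] - G\<close> for some such \<open>A\<close> and \<open>i\<close>, that is, iff a chain from \<open>F\<close> to \<open>[n] - G\<close>
  leaves \<open>\<Delta>\<close>: this says \<open>F \<in> \<Delta>\<close> and \<open>[n] - G \<notin> \<Delta>\<close>.
\<close>

section \<open>Cells and the complexes they generate\<close>

definition cell :: "nat \<Rightarrow> nat set \<Rightarrow> (nat \<times> nat) set" where
  "cell n A = A \<times> {0} \<union> ({1..n} - A) \<times> {1}"

definition cell_complex :: "nat \<Rightarrow> nat set set \<Rightarrow> (nat \<times> nat) set set" where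
  "cell_complex n \<Delta> = {S. \<exists>A\<in>\<Delta>. S \<subseteq> cell n A}"

text \<open>For each \<open>x\<close> in \<open>{1..n}\<close> a cell contains exactly one of
  \<open>(x, 0)\<close> and \<open>(x, 1)\<close>, so an inclusion forces the same choice at every
  index.\<close>

lemma cell_subset_iff:
  assumes "A \<subseteq> {1..n}" "B \<subseteq> {1..n}"
  shows "cell n A \<subseteq> cell n B \<longleftrightarrow> A = B"
proof
  assume sub: "cell n A \<subseteq> cell n B"
  have "x \<in> A \<longleftrightarrow> x \<in> B" if "x \<in> {1..n}" for x
    using subsetD[OF sub, of "(x, 0)"] subsetD[OF sub, of "(x, 1)"] that
    by (auto simp: cell_def)
  then show "A = B" using assms by blast
qed simp

lemma finite_cell: "A \<subseteq> {1..n} \<Longrightarrow> finite (cell n A)"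
  by (auto simp: cell_def intro: finite_subset)

lemma card_cell:
  assumes "A \<subseteq> {1..n}"
  shows "card (cell n A) = n"
proof -
  have "finite A" using assms finite_subset by blast
  then have "card (cell n A) = card A + card ({1..n} - A)"
    unfolding cell_def by (subst card_Un_disjoint) (auto simp: card_cartesian_product)
  moreover have "card A \<le> n" using card_mono[OF _ assms] by simp
  ultimately show ?thesis using assms \<open>finite A\<close> by (simp add: card_Diff_subset)
qed

text \<open>Different cells are incomparable, so each generator of the complex is maximal.\<close>

lemma facets_cell_complex:
  assumes "\<Delta> \<subseteq> Pow {1..n}"
  shows "facets (cell_complex n \<Delta>) = cell n ` \<Delta>"
proof
  show "facets (cell_complex n \<Delta>) \<subseteq> cell n ` \<Delta>"
    by (fastforce simp: facets_def cell_complex_def)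
  show "cell n ` \<Delta> \<subseteq> facets (cell_complex n \<Delta>)"
  proof
    fix S assume "S \<in> cell n ` \<Delta>"
    then obtain A where A: "A \<in> \<Delta>" "S = cell n A" by auto
    have "G = S" if G: "G \<in> cell_complex n \<Delta>" "S \<subseteq> G" for G
    proof -
      obtain B where B: "B \<in> \<Delta>" "G \<subseteq> cell n B"
        using G(1) unfolding cell_complex_def by blast
      then have "cell n A \<subseteq> cell n B" using G A by blast
      then have "A = B" using cell_subset_iff[of A n B] A(1) B(1) assms by blast
      then show ?thesis using A B G by blast
    qed
    then show "S \<in> facets (cell_complex n \<Delta>)"
      using A by (auto simp: facets_def cell_complex_def)
  qed
qed

lemma Max_card_cell_complex:
  assumes "\<Delta> \<subseteq> Pow {1..n}" "\<Delta> \<noteq> {}"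
  shows "Max (card ` cell_complex n \<Delta>) = n"
proof (rule Max_eqI)
  have le: "y \<le> n" if "y \<in> card ` cell_complex n \<Delta>" for y
    using that assms(1) card_cell finite_cell
    by (auto simp: cell_complex_def) (metis PowD card_mono subsetD)
  then show "y \<le> n" if "y \<in> card ` cell_complex n \<Delta>" for y using that .
  show "finite (card ` cell_complex n \<Delta>)"
    using le by (meson finite_nat_set_iff_bounded_le)
  obtain A where A: "A \<in> \<Delta>" using assms by auto
  then have "cell n A \<in> cell_complex n \<Delta>" by (auto simp: cell_complex_def)
  moreover have "A \<subseteq> {1..n}" using A assms(1) by blast
  then have "n = card (cell n A)" by (rule card_cell[symmetric])
  ultimately show "n \<in> card ` cell_complex n \<Delta>" by (intro image_eqI)
qed

section \<open>Ridges and the boundary\<close>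

lemma ridge_subset_cell_iff:
  assumes "A \<subseteq> {1..n}" "B \<subseteq> {1..n}" "i \<in> {1..n} - A"
  shows "cell n A - {(i, 1)} \<subseteq> cell n B \<longleftrightarrow> B = A \<or> B = insert i A"
proof
  assume sub: "cell n A - {(i, 1)} \<subseteq> cell n B"
  \<comment> \<open>For \<open>x\<close> other than \<open>i\<close>, the pair recording whether
    \<open>x\<close> is in \<open>A\<close> survives the deletion; only the choice at
    \<open>i\<close> becomes free.\<close>
  have "x \<in> A \<longleftrightarrow> x \<in> B" if "x \<in> {1..n}" "x \<noteq> i" for x
    using subsetD[OF sub, of "(x, 0)"] subsetD[OF sub, of "(x, 1)"] that
    by (auto simp: cell_def)
  then show "B = A \<or> B = insert i A" using assms by blast
next
  assume "B = A \<or> B = insert i A"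
  then show "cell n A - {(i, 1)} \<subseteq> cell n B" by (auto simp: cell_def)
qed

lemma boundary_cell_complex:
  assumes "\<Delta> \<subseteq> Pow {1..n}" "\<Delta> \<noteq> {}"
    and down: "\<forall>A\<in>\<Delta>. \<forall>B. B \<subseteq> A \<longrightarrow> B \<in> \<Delta>"
  shows "boundary (cell_complex n \<Delta>) =
    {S. \<exists>A i. A \<in> \<Delta> \<and> i \<in> {1..n} - A \<and> insert i A \<notin> \<Delta> \<and> S \<subseteq> cell n A - {(i, 1)}}"
  (is "?L = ?R")
proof
  have b: "boundary (cell_complex n \<Delta>) = {S. \<exists>G\<in>cell_complex n \<Delta>. S \<subseteq> G \<and> card G + 1 = n \<and>
      (\<exists>!F. F \<in> cell n ` \<Delta> \<and> G \<subseteq> F)}"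
    unfolding boundary_def facets_cell_complex[OF assms(1)] Max_card_cell_complex[OF assms(1,2)]
    by (rule refl)
  show "?L \<subseteq> ?R"
  proof
    fix S assume "S \<in> ?L"
    then obtain G where G: "G \<in> cell_complex n \<Delta>" "S \<subseteq> G" "card G + 1 = n"
      and uniq: "\<exists>!F. F \<in> cell n ` \<Delta> \<and> G \<subseteq> F"
      unfolding b mem_Collect_eq by (elim bexE conjE)
    obtain A where A: "A \<in> \<Delta>" "G \<subseteq> cell n A"
      using G(1) unfolding cell_complex_def by blast
    have An: "A \<subseteq> {1..n}" using A assms by auto
    \<comment> \<open>Since \<open>cell n\<close> is injective on subsets of \<open>{1..n}\<close>,
      uniqueness of the facet becomes uniqueness of the index set.\<close>
    have unique: "B = A" if "B \<in> \<Delta>" "G \<subseteq> cell n B" for B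
    proof -
      have "cell n B = cell n A" using that A uniq by (metis imageI)
      then show ?thesis using cell_subset_iff[of B n A] that assms(1) An by blast
    qed
    have "cell n A \<noteq> G"
      using G(3) card_cell[OF An] by auto
    then obtain v where v: "v \<in> cell n A" "v \<notin> G" using A(2) by blast
    then have Gv: "G \<subseteq> cell n A - {v}" using A by auto
    obtain i j where ij: "v = (i, j)" by (cases v)
    \<comment> \<open>Dropping \<open>(i, 0)\<close> with \<open>i\<close> in \<open>A\<close> would
      leave a face that also lies in the cell of \<open>A - {i}\<close>, a member of
      \<open>\<Delta>\<close> by closure under subsets; this contradicts uniqueness.\<close>
    have j: "j = 1"
    proof (rule ccontr)
      assume "j \<noteq> 1"
      then have i: "i \<in> A" "j = 0" using v ij by (auto simp: cell_def)
      then have "cell n A - {v} \<subseteq> cell n (A - {i})"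
        using ij by (auto simp: cell_def)
      then have "G \<subseteq> cell n (A - {i})" using Gv by (rule subset_trans[rotated])
      moreover have "A - {i} \<in> \<Delta>" using down A(1) by (meson Diff_subset)
      ultimately have "A - {i} = A" using unique by metis
      then show False using i(1) by blast
    qed
    then have i: "i \<in> {1..n} - A" using v ij by (auto simp: cell_def)
    \<comment> \<open>The cell of \<open>insert i A\<close> replaces \<open>(i, 1)\<close> by
      \<open>(i, 0)\<close>, so it is a second cell around \<open>G\<close>; uniqueness therefore
      keeps \<open>insert i A\<close> out of \<open>\<Delta>\<close>.\<close>
    have "cell n A - {v} \<subseteq> cell n (insert i A)"
      using ij j by (auto simp: cell_def)
    then have "G \<subseteq> cell n (insert i A)" using Gv by (rule subset_trans[rotated])
    then have "insert i A \<notin> \<Delta>" using unique i by (metis DiffD2 insertI1)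
    moreover have "S \<subseteq> cell n A - {(i, 1)}" using G(2) Gv ij j by blast
    ultimately show "S \<in> ?R" using A(1) i by blast
  qed
  show "?R \<subseteq> ?L"
  proof
    fix S assume "S \<in> ?R"
    then obtain A i where A: "A \<in> \<Delta>" "i \<in> {1..n} - A" "insert i A \<notin> \<Delta>"
      and S: "S \<subseteq> cell n A - {(i, 1)}" by blast
    let ?G = "cell n A - {(i, 1)}"
    have An: "A \<subseteq> {1..n}" using A assms by auto
    have "(i, 1) \<in> cell n A" using A by (auto simp: cell_def)
    then have "card ?G + 1 = n"
      using card_cell[OF An] finite_cell[OF An] A by (simp add: card_Diff_singleton)
    moreover have "\<exists>!F. F \<in> cell n ` \<Delta> \<and> ?G \<subseteq> F"
    proof (rule ex1I[of _ "cell n A"])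
      show "cell n A \<in> cell n ` \<Delta> \<and> ?G \<subseteq> cell n A" using A by blast
      fix F assume "F \<in> cell n ` \<Delta> \<and> ?G \<subseteq> F"
      then obtain B where B: "B \<in> \<Delta>" "F = cell n B" "?G \<subseteq> cell n B" by blast
      then have "B \<subseteq> {1..n}" using assms(1) by blast
      then have "B = A" using ridge_subset_cell_iff[OF An _ A(2)] A(3) B by blast
      then show "F = cell n A" using B(2) by simp
    qed
    moreover have "?G \<in> cell_complex n \<Delta>" using A by (auto simp: cell_complex_def)
    ultimately show "S \<in> ?L"
      using S unfolding b mem_Collect_eq by (intro bexI[of _ ?G] conjI)
  qed
qed

text \<open>Take \<open>A\<close> maximal among the members of \<open>\<Delta>\<close> between
  \<open>F\<close> and \<open>U\<close>. It differs from \<open>U\<close>, and adding any missing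
  point of \<open>U\<close> leaves \<open>\<Delta>\<close> by maximality.\<close>

lemma exists_maximal_between:
  assumes "finite U" "F \<in> \<Delta>" "F \<subseteq> U" "U \<notin> \<Delta>"
  shows "\<exists>A i. A \<in> \<Delta> \<and> F \<subseteq> A \<and> i \<in> U - A \<and> A \<subseteq> U \<and> insert i A \<notin> \<Delta>"
proof -
  have "finite {A \<in> \<Delta>. F \<subseteq> A \<and> A \<subseteq> U}"
    using assms(1) by (auto intro: finite_subset[of _ "Pow U"])
  then obtain A where A: "A \<in> \<Delta>" "F \<subseteq> A" "A \<subseteq> U"
    and max: "\<And>B. B \<in> \<Delta> \<Longrightarrow> F \<subseteq> B \<Longrightarrow> B \<subseteq> U \<Longrightarrow> A \<subseteq> B \<Longrightarrow> A = B"
    using finite_has_maximal2[of "{A \<in> \<Delta>. F \<subseteq> A \<and> A \<subseteq> U}" F] assms by auto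
  have "A \<noteq> U" using A(1) assms(4) by blast
  then obtain i where i: "i \<in> U - A" using A(3) by blast
  then have "insert i A \<notin> \<Delta>" using max[of "insert i A"] A by auto
  then show ?thesis using A i by blast
qed

text \<open>The right-hand side is the deleted join of \<open>\<Delta>\<close> and its Alexander
  dual, with \<open>\<Delta>\<close> on level 0 and the dual on level 1: the Bier sphere with pairs
  as vertices.\<close>

lemma boundary_cell_complex_eq_deleted_join:
  assumes "\<Delta> \<subseteq> Pow {1..n}" "\<Delta> \<noteq> {}"
    and down: "\<forall>A\<in>\<Delta>. \<forall>B. B \<subseteq> A \<longrightarrow> B \<in> \<Delta>"
  shows "boundary (cell_complex n \<Delta>) =
    {F \<times> {0} \<union> G \<times> {1} | F G. F \<in> \<Delta> \<and> G \<in> alexander_dual n \<Delta> \<and> F \<inter> G = {}}"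
  (is "?L = ?R")
proof (intro equalityI subsetI)
  fix S assume "S \<in> ?L"
  then obtain A i where A: "A \<in> \<Delta>" "i \<in> {1..n}" "i \<notin> A" "insert i A \<notin> \<Delta>"
    and S: "S \<subseteq> cell n A - {(i, 1)}"
    unfolding boundary_cell_complex[OF assms] by blast
  let ?F = "{k. (k, 0) \<in> S}" and ?G = "{k. (k, 1) \<in> S}"
  have F: "?F \<subseteq> A" and G: "?G \<subseteq> {1..n} - insert i A"
    using S by (auto simp: cell_def)
  have An: "A \<subseteq> {1..n}" using A assms(1) by auto
  \<comment> \<open>Supersets of nonfaces are nonfaces, so the complement of \<open>?G\<close>
    inherits this from \<open>insert i A\<close>.\<close>
  have "insert i A \<subseteq> {1..n} - ?G" using G A An by blast
  then have "{1..n} - ?G \<notin> \<Delta>" using down A by blast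
  then have "?G \<in> alexander_dual n \<Delta>" using G by (auto simp: alexander_dual_def)
  moreover have "?F \<in> \<Delta>" using F A down by blast
  moreover have "S = ?F \<times> {0} \<union> ?G \<times> {1}" using S by (auto simp: cell_def)
  moreover have "?F \<inter> ?G = {}" using F G by blast
  ultimately show "S \<in> ?R" by blast
next
  fix S assume "S \<in> ?R"
  then obtain F G where F: "F \<in> \<Delta>" and G: "G \<in> alexander_dual n \<Delta>" and FG: "F \<inter> G = {}"
    and S: "S = F \<times> {0} \<union> G \<times> {1}" by blast
  have "F \<subseteq> {1..n} - G" "{1..n} - G \<notin> \<Delta>" and Gn: "G \<subseteq> {1..n}"
    using F G FG assms(1) by (auto simp: alexander_dual_def)
  then obtain A i where A: "A \<in> \<Delta>" "F \<subseteq> A" "i \<in> ({1..n} - G) - A" "A \<subseteq> {1..n} - G"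
      "insert i A \<notin> \<Delta>"
    using exists_maximal_between[of "{1..n} - G" F \<Delta>] F by auto
  \<comment> \<open>Level 0 uses that \<open>F\<close> lies in \<open>A\<close>; level 1 uses that
    \<open>G\<close> avoids both \<open>A\<close> and \<open>i\<close>.\<close>
  then have "S \<subseteq> cell n A - {(i, 1)}"
    using Gn unfolding S by (auto simp: cell_def)
  then show "S \<in> ?L" unfolding boundary_cell_complex[OF assms] using A by blast
qed

section \<open>From exponent vectors to subsets of \<open>{1..n}\<close>\<close>

lemma F_c_squarefree_monomial:
  assumes "\<And>i. i \<in> {1..n} \<Longrightarrow> c i = 1" "A \<subseteq> {1..n}"
  shows "F_c n c (squarefree_monomial A) = cell n A"
proof (rule set_eqI, clarify)
  fix i j
  show "(i, j) \<in> F_c n c (squarefree_monomial A) \<longleftrightarrow> (i, j) \<in> cell n A"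
  proof (cases "i \<in> {1..n}")
    case True
    \<comment> \<open>\<open>F_c\<close> removes the symbol carrying the actual exponent: exponent 1
      leaves \<open>(i, 0)\<close> and exponent 0 leaves \<open>(i, 1)\<close>.\<close>
    then show ?thesis using assms(1)[OF True]
      by (auto simp: F_c_def Xtilde_def cell_def squarefree_monomial_def)
  next
    case False
    then show ?thesis using assms(2) by (auto simp: F_c_def Xtilde_def cell_def)
  qed
qed

lemma multicomplex_eq_squarefree:
  assumes "\<And>i. i \<in> {1..n} \<Longrightarrow> c i = 1" "M \<subseteq> c_monomials n c"
  shows "M = squarefree_monomial ` complex_of_multicomplex n M"
proof
  show "M \<subseteq> squarefree_monomial ` complex_of_multicomplex n M"
  proof
    fix a assume a: "a \<in> M"
    \<comment> \<open>With exponents at most 1, this is the support of \<open>a\<close>, which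
      determines \<open>a\<close>.\<close>
    let ?A = "{i \<in> {1..n}. a i = 1}"
    have "a i = squarefree_monomial ?A i" for i
    proof (cases "i \<in> {1..n}")
      case True
      then have "a i \<le> 1" using a assms by (force simp: c_monomials_def)
      then show ?thesis using True by (auto simp: squarefree_monomial_def)
    next
      case False
      then show ?thesis using a assms(2) by (auto simp: c_monomials_def squarefree_monomial_def)
    qed
    then have "a = squarefree_monomial ?A" by blast
    then show "a \<in> squarefree_monomial ` complex_of_multicomplex n M"
      using a by (intro image_eqI[of _ _ ?A]) (auto simp: complex_of_multicomplex_def)
  qed
qed (auto simp: complex_of_multicomplex_def)

lemma B_c_eq_cell_complex:
  assumes "\<And>i. i \<in> {1..n} \<Longrightarrow> c i = 1" "M \<subseteq> c_monomials n c"
  shows "B_c n c M = cell_complex n (complex_of_multicomplex n M)"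
proof -
  let ?\<Delta> = "complex_of_multicomplex n M"
  have "B_c n c M = {S. \<exists>A\<in>?\<Delta>. S \<subseteq> F_c n c (squarefree_monomial A)}"
    by (subst multicomplex_eq_squarefree[OF assms]) (auto simp: B_c_def)
  also have "\<dots> = cell_complex n ?\<Delta>"
    using F_c_squarefree_monomial[OF assms(1)]
    by (auto simp: cell_complex_def complex_of_multicomplex_def)
  finally show ?thesis .
qed

theorem theorem1p13:
  fixes n :: nat and c :: "nat \<Rightarrow> nat" and M :: "(nat \<Rightarrow> nat) set"
  assumes "\<And>i. i \<in> {1..n} \<Longrightarrow> c i = 1"
    and "proper_c_multicomplex n c M"
  shows "combinatorially_isomorphic
           (Xtilde n c) (Bier_c n c M)
           (Bier_vertices n) (Bier n (complex_of_multicomplex n M))"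
proof -
  let ?\<Delta> = "complex_of_multicomplex n M"
  have M: "M \<noteq> {}" "M \<subseteq> c_monomials n c"
    and div: "\<And>a b. a \<in> M \<Longrightarrow> (\<And>i. b i \<le> a i) \<Longrightarrow> b \<in> M"
    using assms(2) by (auto simp: proper_c_multicomplex_def c_multicomplex_def)
  have sub: "?\<Delta> \<subseteq> Pow {1..n}" by (auto simp: complex_of_multicomplex_def)
  have ne: "?\<Delta> \<noteq> {}" using multicomplex_eq_squarefree[OF assms(1) M(2)] M(1) by auto
  have down: "\<forall>A\<in>?\<Delta>. \<forall>B. B \<subseteq> A \<longrightarrow> B \<in> ?\<Delta>"
  proof (intro ballI allI impI)
    fix A B assume that: "A \<in> ?\<Delta>" "B \<subseteq> A"
    \<comment> \<open>Inclusion of supports is divisibility of squarefree monomials, so closure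
      under divisors becomes closure under subsets.\<close>
    have "squarefree_monomial B i \<le> squarefree_monomial A i" for i
      using that(2) by (auto simp: squarefree_monomial_def)
    then show "B \<in> ?\<Delta>"
      using div[of "squarefree_monomial A" "squarefree_monomial B"] that
      by (auto simp: complex_of_multicomplex_def)
  qed
  have X: "Xtilde n c = {1..n} \<times> {0, 1}"
    using assms(1) by (auto simp: Xtilde_def le_Suc_eq)
  have Bier_c: "Bier_c n c M =
      {F \<times> {0} \<union> G \<times> {1} | F G. F \<in> ?\<Delta> \<and> G \<in> alexander_dual n ?\<Delta> \<and> F \<inter> G = {}}"
    using boundary_cell_complex_eq_deleted_join[OF sub ne down]
      B_c_eq_cell_complex[OF assms(1) M(2)] by (simp only: Bier_c_def)
  \<comment> \<open>Level 0 becomes the \<open>x\<close>-vertices and level 1 the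
    \<open>y\<close>-vertices. All nonzero levels are merged, so injectivity is claimed only on
    \<open>Xtilde n c\<close>.\<close>
  define f :: "nat \<times> nat \<Rightarrow> nat + nat" where
    "f = (\<lambda>(i, j). if j = 0 then Inl i else Inr i)"
  have f_image: "f ` (F \<times> {0} \<union> G \<times> {1}) = Inl ` F \<union> Inr ` G" for F G
    by (force simp: f_def image_iff)
  \<comment> \<open>In this form the vertex set is the instance of \<open>f_image\<close> with both
    sets equal to \<open>{1..n}\<close>.\<close>
  have X': "Xtilde n c = {1..n} \<times> {0} \<union> {1..n} \<times> {1}"
    unfolding X by blast
  have "inj_on f (Xtilde n c)"
    unfolding X by (auto simp: f_def inj_on_def)
  then have "bij_betw f (Xtilde n c) (Bier_vertices n)"
    unfolding bij_betw_def X' f_image Bier_vertices_def by blast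
  moreover have "(\<lambda>S. f ` S) ` Bier_c n c M = Bier n ?\<Delta>"
    unfolding Bier_c Bier_def f_image[symmetric] by blast
  moreover have "Bier_c n c M \<subseteq> Pow (Xtilde n c)"
    unfolding Bier_c X using sub by (auto simp: alexander_dual_def)
  moreover have "Bier n ?\<Delta> \<subseteq> Pow (Bier_vertices n)"
    using sub by (auto simp: Bier_def Bier_vertices_def alexander_dual_def)
  ultimately show ?thesis
    unfolding combinatorially_isomorphic_def by blast
qed

end
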